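(* Let $G=(\mathcal V,\mathcal E)$ be a finite connected unweighted undirected graph and let $D\ge1$ be the pre-set maximum number of iterations. In a failure-free scenario, for every node $v_i\in\mathcal V$, the number $\Delta_i^{(D)}=Y_i^{(D)}-P_i^{(D)}$ of messages saved by $v_i$ by using the pruning method instead of the YTQ method is $$\Delta^{(D)}_{i}=\sum_{t=1}^{\min(D,H_i,L_i)}\ \sum_{l=0}^{t-1}u_i^{(l)}\;+\;\sum_{t=\min(D,H_i,L_i)+1}^{\min(D,H_i)}\left(d_i-\sum_{l=0}^{t-1}h_i^{(l)}\right).$$
   Context: Nodes of $G$ exchange neighbourhood information in rounds (iterations) $t=1,2,\dots,D$ in a failure-free setting. $\mathcal N_i$ is the set of immediate neighbours of $v_i$ and $d_i=|\mathcal N_i|$. For $t\ge0$, $\mathcal N_i^{(t)}$ is the set of nodes at distance exactly $t+1$ from $v_i$; $v_i$ reaches equilibrium at iteration $t$ when $\mathcal N_i^{(t)}=\emptyset$ (it learns nothing new), and it then stops taking part. YTQ method: in every round each node that has not reached equilibrium sends its newest neighbourhood information to its immediate neighbours (a distributed breadth-first search from every node). Pruning method: the same, except that at the end of each iteration some nodes are pruned (after the first iteration leaves, and degree-2 nodes whose two neighbours are adjacent; later, nodes that have no new information to share with their remaining neighbours). Each node knows which of its neighbours are pruned. A pruned node neither sends nor waits for messages in subsequent iterations. Notation: - $H_i$ is the iteration after which $v_i$ reaches equilibrium; this value is the same for both methods. - $L_i\ge1$ is the round at which $v_i$ is pruned in the pruning method, with $L_i=+\infty$ if $v_i$ is never pruned.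 - $h_i^{(t)}$ is the number of neighbours of $v_i$ that reach equilibrium at the end of iteration $t$ (the same numbers are used for both methods), and $u_i^{(t)}$ is the number of neighbours of $v_i$ that are pruned at the end of iteration $t$ (both count only the nodes newly doing so at iteration $t$). $h_i^{(0)}=u_i^{(0)}=0$. - A pruned node does not reach equilibrium in the pruning method, so in the rounds in which $v_i$ takes part in the pruning method no neighbour is counted both among those pruned and among those in equilibrium by the end of the preceding round. Message counting: in the YTQ method $v_i$ takes part in rounds $t=1,\dots,\min(D,H_i)$ only, and in each such round $t$ receives exactly one message from each neighbour that has not reached equilibrium by the end of round $t-1$; $Y_i^{(D)}$ is the total number of messages received, that is, $Y_i^{(D)}=\sum_{t=1}^{\min(D,H_i)}\bigl(d_i-\sum_{l=0}^{t-1}h_i^{(l)}\bigr)$. In the pruning method $v_i$ takes part in rounds $t=1,\dots,\min(D,H_i,L_i)$ only, and in each such round $t$ receives exactly one message from each neighbour that has neither reached equilibrium nor been pruned by the end of round $t-1$; $P_i^{(D)}$ is the total number of messages received. An empty sum is $0$. *)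

theory Defs
  imports Main "HOL-Library.Extended_Nat"
begin

definition connected_graph :: "'a set \<Rightarrow> ('a \<times> 'a) set \<Rightarrow> bool" where
  "connected_graph V E \<longleftrightarrow>
     finite V \<and> E \<subseteq> V \<times> V \<and> sym E \<and> irrefl E \<and> (\<forall>u\<in>V. \<forall>v\<in>V. (u, v) \<in> E\<^sup>*)"

definition neighbours :: "('a \<times> 'a) set \<Rightarrow> 'a \<Rightarrow> 'a set" where
  "neighbours E i = {j. (i, j) \<in> E}"

definition deg :: "('a \<times> 'a) set \<Rightarrow> 'a \<Rightarrow> nat" where
  "deg E i = card (neighbours E i)"

text \<open>Length of a shortest walk; only meaningful when \<open>v\<close> is reachable from \<open>u\<close>, which
  always holds between vertices of a connected graph.\<close>

definition gdist :: "('a \<times> 'a) set \<Rightarrow> 'a \<Rightarrow> 'a \<Rightarrow> nat" where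
  "gdist E u v = (LEAST n. (u, v) \<in> E ^^ n)"

text \<open>The set of nodes at distance exactly \<open>t + 1\<close>: what \<open>i\<close> newly learns in round \<open>t\<close>
  (for \<open>t = 0\<close>, its initial information, the immediate neighbours).\<close>

definition layer :: "'a set \<Rightarrow> ('a \<times> 'a) set \<Rightarrow> 'a \<Rightarrow> nat \<Rightarrow> 'a set" where
  "layer V E i t = {v \<in> V. gdist E i v = t + 1}"

definition known :: "'a set \<Rightarrow> ('a \<times> 'a) set \<Rightarrow> 'a \<Rightarrow> nat \<Rightarrow> 'a set" where
  "known V E i t = insert i (\<Union>s\<le>t. layer V E i s)"

text \<open>The iteration \<open>H\<^sub>i\<close>.\<close>

definition equilibrium_round :: "'a set \<Rightarrow> ('a \<times> 'a) set \<Rightarrow> 'a \<Rightarrow> nat" where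
  "equilibrium_round V E i = (LEAST t. layer V E i t = {})"

definition first_prunable :: "('a \<times> 'a) set \<Rightarrow> 'a \<Rightarrow> bool" where
  "first_prunable E j \<longleftrightarrow>
     deg E j = 1 \<or> (\<exists>a b. a \<noteq> b \<and> neighbours E j = {a, b} \<and> (a, b) \<in> E)"

text \<open>Below, \<open>L j\<close> is the iteration at the end of which \<open>j\<close> is pruned (\<open>\<infinity>\<close> if never).
  At the end of iteration \<open>t\<close> the remaining neighbours of \<open>j\<close> are those not pruned in an
  earlier iteration; \<open>j\<close> has no new information for them if each of them already has
  everything that \<open>j\<close> would send next. Neighbours in equilibrium know all of \<open>V\<close>, so it is
  immaterial whether they count as remaining.\<close>

definition nothing_new ::
    "'a set \<Rightarrow> ('a \<times> 'a) set \<Rightarrow> ('a \<Rightarrow> enat) \<Rightarrow> 'a \<Rightarrow> nat \<Rightarrow> bool" where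
  "nothing_new V E L j t \<longleftrightarrow>
     (\<forall>k \<in> neighbours E j. enat t \<le> L k \<longrightarrow> layer V E j t \<subseteq> known V E k t)"

text \<open>The pruning times \<open>L\<close> of a run of the pruning method. A node that reaches equilibrium
  at the end of iteration \<open>t\<close> or earlier is not pruned at \<open>t\<close>. From the second iteration on,
  only nodes with nothing new to share are pruned; as a node may be unable to detect
  locally that it is in this situation, it is not required that all of them are. Thus every
  pruning criterion that implies \<open>nothing_new\<close> is covered, including \<open>nothing_new\<close> itself.\<close>

definition pruning_run :: "'a set \<Rightarrow> ('a \<times> 'a) set \<Rightarrow> ('a \<Rightarrow> enat) \<Rightarrow> bool" where
  "pruning_run V E L \<longleftrightarrow> (\<forall>j\<in>V.
     1 \<le> L j \<and>
     (L j = 1 \<longleftrightarrow> first_prunable E j \<and> 1 < equilibrium_round V E j) \<and>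
     (\<forall>t\<ge>2. L j = enat t \<longrightarrow> nothing_new V E L j t \<and> t < equilibrium_round V E j))"

text \<open>The numbers \<open>h\<close> and \<open>u\<close>. In a connected graph a node that has a neighbour has a
  nonempty layer 0, so \<open>new_equilibrium V E i 0 = 0\<close>; and \<open>new_pruned E L i 0 = 0\<close> in a
  pruning run since there all pruning times are at least 1.\<close>

definition new_equilibrium :: "'a set \<Rightarrow> ('a \<times> 'a) set \<Rightarrow> 'a \<Rightarrow> nat \<Rightarrow> nat" where
  "new_equilibrium V E i t = card {j \<in> neighbours E i. equilibrium_round V E j = t}"

definition new_pruned :: "('a \<times> 'a) set \<Rightarrow> ('a \<Rightarrow> enat) \<Rightarrow> 'a \<Rightarrow> nat \<Rightarrow> nat" where
  "new_pruned E L i t = card {j \<in> neighbours E i. L j = enat t}"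

text \<open>The neighbours from which \<open>i\<close> receives a message in round \<open>t \<ge> 1\<close>.\<close>

definition ytq_senders :: "'a set \<Rightarrow> ('a \<times> 'a) set \<Rightarrow> 'a \<Rightarrow> nat \<Rightarrow> 'a set" where
  "ytq_senders V E i t = {j \<in> neighbours E i. \<not> equilibrium_round V E j \<le> t - 1}"

definition pruning_senders ::
    "'a set \<Rightarrow> ('a \<times> 'a) set \<Rightarrow> ('a \<Rightarrow> enat) \<Rightarrow> 'a \<Rightarrow> nat \<Rightarrow> 'a set" where
  "pruning_senders V E L i t =
     {j \<in> neighbours E i. \<not> equilibrium_round V E j \<le> t - 1 \<and> \<not> L j \<le> enat (t - 1)}"

definition ytq_last :: "'a set \<Rightarrow> ('a \<times> 'a) set \<Rightarrow> nat \<Rightarrow> 'a \<Rightarrow> nat" where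
  "ytq_last V E D i = min D (equilibrium_round V E i)"

definition pruning_last ::
    "'a set \<Rightarrow> ('a \<times> 'a) set \<Rightarrow> ('a \<Rightarrow> enat) \<Rightarrow> nat \<Rightarrow> 'a \<Rightarrow> nat" where
  "pruning_last V E L D i =
     the_enat (min (min (enat D) (enat (equilibrium_round V E i))) (L i))"

definition ytq_messages :: "'a set \<Rightarrow> ('a \<times> 'a) set \<Rightarrow> nat \<Rightarrow> 'a \<Rightarrow> nat" where
  "ytq_messages V E D i = (\<Sum>t = 1..ytq_last V E D i. card (ytq_senders V E i t))"

definition pruning_messages ::
    "'a set \<Rightarrow> ('a \<times> 'a) set \<Rightarrow> ('a \<Rightarrow> enat) \<Rightarrow> nat \<Rightarrow> 'a \<Rightarrow> nat" where
  "pruning_messages V E L D i =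
     (\<Sum>t = 1..pruning_last V E L D i. card (pruning_senders V E L i t))"

definition messages_saved ::
    "'a set \<Rightarrow> ('a \<times> 'a) set \<Rightarrow> ('a \<Rightarrow> enat) \<Rightarrow> nat \<Rightarrow> 'a \<Rightarrow> int" where
  "messages_saved V E L D i =
     int (ytq_messages V E D i) - int (pruning_messages V E L D i)"

end

theory Submission
  imports Defs
begin

text \<open>Only disjointness is at stake: while \<open>i\<close> takes part, no neighbour \<open>j\<close> is both pruned and
  in equilibrium. Suppose \<open>j\<close> was pruned at \<open>s < H\<^sub>j\<close> and \<open>H\<^sub>j < t \<le> H\<^sub>i\<close>. A node \<open>w\<close> at distance
  \<open>t\<close> from \<open>i\<close> is then at distance exactly \<open>t - 1\<close> from \<open>j\<close>. Take the node \<open>x\<close> at distance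
  \<open>s + 1\<close> from \<open>j\<close> on a shortest path to \<open>w\<close>. The pruning criterion says that \<open>x\<close> is within
  distance \<open>s + 1\<close> of \<open>i\<close>, so \<open>w\<close> is within distance \<open>t - 1\<close> of \<open>i\<close>, a contradiction.\<close>

lemma gdist_le: "(u, v) \<in> E ^^ n \<Longrightarrow> gdist E u v \<le> n"
  unfolding gdist_def by (rule Least_le)

lemma gdist_self [simp]: "gdist E u u = 0"
  using gdist_le[where n = 0 and u = u and v = u and E = E] by simp

lemma relpow_gdist:
  assumes "(u, v) \<in> E\<^sup>*"
  shows "(u, v) \<in> E ^^ gdist E u v"
proof -
  obtain n where "(u, v) \<in> E ^^ n" using assms rtrancl_imp_relpow by blast
  then show ?thesis unfolding gdist_def by (rule LeastI)
qed

text \<open>A shortest walk is cut after \<open>m\<close> steps. The vertex there cannot be closer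
  to \<open>u\<close>, since a shortcut to it would shorten the whole walk.\<close>

lemma gdist_intermediate:
  assumes "(u, w) \<in> E\<^sup>*" "m \<le> gdist E u w"
  obtains x where "(u, x) \<in> E ^^ m" "gdist E u x = m" "(x, w) \<in> E ^^ (gdist E u w - m)"
proof -
  have "(u, w) \<in> E ^^ (m + (gdist E u w - m))"
    using relpow_gdist[OF assms(1)] assms(2) by simp
  then obtain x where x: "(u, x) \<in> E ^^ m" "(x, w) \<in> E ^^ (gdist E u w - m)"
    unfolding relpow_add by blast
  have "(u, w) \<in> E ^^ (gdist E u x + (gdist E u w - m))"
    unfolding relpow_add using relpow_gdist[OF relpow_imp_rtrancl[OF x(1)]] x(2) by blast
  then have "gdist E u w \<le> gdist E u x + (gdist E u w - m)" by (rule gdist_le)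
  with gdist_le[OF x(1)] assms(2) have "gdist E u x = m" by linarith
  with x show thesis using that by blast
qed

lemma gdist_le_if_known:
  assumes "x \<in> known V E i s"
  shows "gdist E i x \<le> s + 1"
  using assms unfolding known_def layer_def by auto

context
  fixes V :: "'a set" and E :: "('a \<times> 'a) set"
  assumes conn: "connected_graph V E"
begin

lemma reachable: "u \<in> V \<Longrightarrow> v \<in> V \<Longrightarrow> (u, v) \<in> E\<^sup>*"
  using conn unfolding connected_graph_def by blast

lemma edge_sym: "(u, v) \<in> E \<Longrightarrow> (v, u) \<in> E"
  using conn unfolding connected_graph_def sym_def by blast

lemma edge_in_V: "(u, v) \<in> E \<Longrightarrow> u \<in> V \<and> v \<in> V"
  using conn unfolding connected_graph_def by blast

lemma relpow_in_V: "(u, v) \<in> E ^^ n \<Longrightarrow> u \<in> V \<Longrightarrow> v \<in> V"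
  by (cases n) (auto dest: edge_in_V)

lemma finite_neighbours: "finite (neighbours E i)"
proof -
  have "neighbours E i \<subseteq> V" unfolding neighbours_def using edge_in_V by blast
  then show ?thesis using conn finite_subset unfolding connected_graph_def by blast
qed

lemma layer_equilibrium_empty: "layer V E j (equilibrium_round V E j) = {}"
proof -
  have "finite (gdist E j ` V)" using conn unfolding connected_graph_def by simp
  then obtain t where "\<forall>n \<in> gdist E j ` V. n \<le> t" using finite_nat_set_iff_bounded_le by blast
  then have "layer V E j t = {}" unfolding layer_def by force
  then show ?thesis unfolding equilibrium_round_def by (rule LeastI)
qed

text \<open>Distances leave no gaps: a farther node would put a vertex of a shortest walk into the
  layer that is empty at equilibrium.\<close>

lemma gdist_le_equilibrium:
  assumes "j \<in> V" "w \<in> V"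
  shows "gdist E j w \<le> equilibrium_round V E j"
proof (rule ccontr)
  assume "\<not> ?thesis"
  then have "equilibrium_round V E j + 1 \<le> gdist E j w" by simp
  from gdist_intermediate[OF reachable[OF assms] this] obtain x where
    "(j, x) \<in> E ^^ (equilibrium_round V E j + 1)" "gdist E j x = equilibrium_round V E j + 1" .
  moreover from relpow_in_V[OF this(1) assms(1)] have "x \<in> V" .
  ultimately have "x \<in> layer V E j (equilibrium_round V E j)"
    unfolding layer_def by simp
  then show False using layer_equilibrium_empty by blast
qed

text \<open>Minimality of the equilibrium round makes every earlier layer inhabited, and layer
  \<open>t - 1\<close> holds distance \<open>t\<close>. With the preceding bound, the equilibrium
  round of a node in \<open>V\<close> is its eccentricity.\<close>

lemma node_at_gdist:
  assumes "1 \<le> t" "t \<le> equilibrium_round V E i"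
  obtains w where "w \<in> V" "gdist E i w = t"
proof -
  have "layer V E i (t - 1) \<noteq> {}"
    using not_less_Least[of "t - 1" "\<lambda>t. layer V E i t = {}"] assms
    unfolding equilibrium_round_def by simp
  then show thesis using that assms(1) unfolding layer_def by auto
qed

text \<open>Turns the local criterion of the first iteration into the inclusion that
  \<open>nothing_new\<close> demands later, so that both kinds of pruning can be treated
  alike.\<close>

lemma first_prunable_nothing_new:
  assumes "first_prunable E j" "i \<in> neighbours E j"
  shows "layer V E j 1 \<subseteq> known V E i 1"
proof
  fix x assume "x \<in> layer V E j 1"
  then have x: "x \<in> V" "gdist E j x = 2" unfolding layer_def by auto
  have j: "j \<in> V" and i: "i \<in> V" and ji: "(j, i) \<in> E"
    using assms(2) edge_in_V unfolding neighbours_def by blast+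
  obtain y where y: "(j, y) \<in> E" "(y, x) \<in> E"
    using relpow_gdist[OF reachable[OF j x(1)]] x(2) by (auto simp: numeral_2_eq_2)
  \<comment> \<open>A leaf has no neighbour besides \<open>i\<close>; in the triangle case the other
    neighbour of \<open>j\<close> is adjacent to \<open>i\<close>.\<close>
  have "y = i \<or> (i, y) \<in> E"
    using assms(1) unfolding first_prunable_def
  proof
    assume "deg E j = 1"
    then obtain k where "neighbours E j = {k}" unfolding deg_def by (meson card_1_singletonE)
    then show ?thesis using assms(2) y(1) unfolding neighbours_def by auto
  next
    assume "\<exists>a b. a \<noteq> b \<and> neighbours E j = {a, b} \<and> (a, b) \<in> E"
    then obtain a b where "neighbours E j = {a, b}" "(a, b) \<in> E" "(b, a) \<in> E"
      using edge_sym by blast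
    moreover from this(1) have "i = a \<or> i = b" "y = a \<or> y = b"
      using assms(2) y(1) unfolding neighbours_def by auto
    ultimately show ?thesis by auto
  qed
  then have "gdist E i x \<le> 2"
  proof
    assume "y = i"
    then show ?thesis using gdist_le[where n = 1 and u = i and v = x and E = E] y(2) by simp
  next
    assume "(i, y) \<in> E"
    then have "(i, x) \<in> E ^^ (1 + 1)" unfolding relpow_add using y(2) by auto
    from gdist_le[OF this] show ?thesis by simp
  qed
  \<comment> \<open>Layers start at distance 1, so distance 0 is covered only by the
    \<open>insert\<close> in \<open>known\<close>.\<close>
  moreover have "x = i" if "gdist E i x = 0"
    using relpow_gdist[OF reachable[OF i x(1)]] that by simp
  ultimately consider "x = i" | "gdist E i x = 0 + 1" | "gdist E i x = 1 + 1"
    by linarith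
  then show "x \<in> known V E i 1"
  proof cases
    case 2
    then have "x \<in> layer V E i 0" unfolding layer_def using x(1) by simp
    then show ?thesis unfolding known_def by blast
  next
    case 3
    then have "x \<in> layer V E i 1" unfolding layer_def using x(1) by simp
    then show ?thesis unfolding known_def by blast
  qed (simp add: known_def)
qed

text \<open>The bound by the equilibrium round of \<open>i\<close> supplies a node at distance
  \<open>t\<close>; \<open>enat t \<le> L i\<close> keeps \<open>i\<close> among the remaining
  neighbours of \<open>j\<close> when \<open>j\<close> is pruned, so the criterion speaks about
  \<open>i\<close>.\<close>

lemma pruned_not_equilibrium:
  assumes run: "pruning_run V E L" and ij: "j \<in> neighbours E i"
    and t: "1 \<le> t" "t \<le> equilibrium_round V E i" "enat t \<le> L i"
    and pruned: "L j \<le> enat (t - 1)"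
  shows "t \<le> equilibrium_round V E j"
proof (rule ccontr)
  assume "\<not> ?thesis"
  then have Hj: "equilibrium_round V E j \<le> t - 1" by simp
  have edge: "(i, j) \<in> E" using ij unfolding neighbours_def by simp
  then have i: "i \<in> V" and j: "j \<in> V" and ji: "i \<in> neighbours E j"
    using edge_in_V edge_sym unfolding neighbours_def by blast+
  obtain s where s: "L j = enat s" "s \<le> t - 1" using pruned by (cases "L j") auto
  have "1 \<le> L j" using run j unfolding pruning_run_def by blast
  then have "1 \<le> s" unfolding s(1) by (simp add: one_enat_def)
  have new: "layer V E j s \<subseteq> known V E i s \<and> s < equilibrium_round V E j"
  proof (cases "s = 1")
    case True
    then have "first_prunable E j \<and> 1 < equilibrium_round V E j"
      using run j s(1) unfolding pruning_run_def by (auto simp: one_enat_def)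
    then show ?thesis using first_prunable_nothing_new[OF _ ji] True by blast
  next
    case False
    then have "nothing_new V E L j s \<and> s < equilibrium_round V E j"
      using run j s(1) \<open>1 \<le> s\<close> unfolding pruning_run_def by simp
    moreover have "enat s \<le> L i" using order_trans[OF _ t(3)] s(2) by simp
    ultimately show ?thesis using ji unfolding nothing_new_def by blast
  qed
  obtain w where w: "w \<in> V" "gdist E i w = t" using node_at_gdist t(1,2) by blast
  have jw: "(j, w) \<in> E\<^sup>*" using reachable[OF j w(1)] .
  have "(i, w) \<in> E ^^ (1 + gdist E j w)"
    unfolding relpow_add using edge relpow_gdist[OF jw] by auto
  from gdist_le[OF this] have "t \<le> 1 + gdist E j w" unfolding w(2) .
  \<comment> \<open>The edge gives distance at least \<open>t - 1\<close>, the equilibrium of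
    \<open>j\<close> at most that, so all these bounds are equalities.\<close>
  with gdist_le_equilibrium[OF j w(1)] Hj have d: "gdist E j w = t - 1"
    "equilibrium_round V E j = t - 1" by linarith+
  \<comment> \<open>Pruning happens strictly before equilibrium, which leaves room for a vertex at
    distance \<open>s + 1\<close> on the walk to \<open>w\<close>.\<close>
  have s1: "s + 1 \<le> gdist E j w" using new d by simp
  obtain x where x: "(j, x) \<in> E ^^ (s + 1)" "gdist E j x = s + 1"
      "(x, w) \<in> E ^^ (gdist E j w - (s + 1))"
    using gdist_intermediate[OF jw s1] .
  have xV: "x \<in> V" using relpow_in_V[OF x(1) j] .
  then have "x \<in> layer V E j s" unfolding layer_def using x(2) by simp
  then have "gdist E i x \<le> s + 1" using new by (intro gdist_le_if_known) blast
  \<comment> \<open>Starting at \<open>i\<close> instead of \<open>j\<close> costs nothing up to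
    \<open>x\<close>, so \<open>w\<close> would be within \<open>t - 1\<close> of
    \<open>i\<close>.\<close>
  moreover have "(i, w) \<in> E ^^ (gdist E i x + (gdist E j w - (s + 1)))"
    unfolding relpow_add using relpow_gdist[OF reachable[OF i xV]] x(3) by blast
  from gdist_le[OF this] have "t \<le> gdist E i x + (gdist E j w - (s + 1))" unfolding w(2) .
  ultimately show False using s1 d(1) t(1) by linarith
qed

lemma sum_new_equilibrium:
  "(\<Sum>l = 0..n. new_equilibrium V E i l)
     = card {j \<in> neighbours E i. equilibrium_round V E j \<le> n}"
proof -
  have "{j \<in> neighbours E i. equilibrium_round V E j \<le> n}
      = (\<Union>l\<in>{0..n}. {j \<in> neighbours E i. equilibrium_round V E j = l})" by auto
  then show ?thesis unfolding new_equilibrium_def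
    by (simp only:) (rule card_UN_disjoint[symmetric], auto simp: finite_neighbours)
qed

lemma sum_new_pruned:
  "(\<Sum>l = 0..n. new_pruned E L i l) = card {j \<in> neighbours E i. L j \<le> enat n}"
proof -
  have "{j \<in> neighbours E i. L j \<le> enat n} = (\<Union>l\<in>{0..n}. {j \<in> neighbours E i. L j = enat l})"
  proof (rule set_eqI)
    show "j \<in> {j \<in> neighbours E i. L j \<le> enat n}
        \<longleftrightarrow> j \<in> (\<Union>l\<in>{0..n}. {j \<in> neighbours E i. L j = enat l})" for j
      \<comment> \<open>A node that is never pruned has \<open>L j = \<infinity>\<close> and lies in
        neither set.\<close>
      by (cases "L j") auto
  qed
  then show ?thesis unfolding new_pruned_def
    by (simp only:) (rule card_UN_disjoint[symmetric], auto simp: finite_neighbours)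
qed

lemma card_ytq_senders:
  "int (card (ytq_senders V E i t))
     = int (deg E i) - (\<Sum>l = 0..t - 1. int (new_equilibrium V E i l))"
proof -
  let ?Q = "{j \<in> neighbours E i. equilibrium_round V E j \<le> t - 1}"
  have "neighbours E i = ytq_senders V E i t \<union> ?Q" unfolding ytq_senders_def by auto
  moreover have "card (ytq_senders V E i t \<union> ?Q) = card (ytq_senders V E i t) + card ?Q"
    by (rule card_Un_disjoint) (auto simp: ytq_senders_def finite_neighbours)
  ultimately have "deg E i = card (ytq_senders V E i t) + card ?Q" unfolding deg_def by simp
  then show ?thesis using sum_new_equilibrium[of i "t - 1"] by (simp flip: of_nat_sum)
qed

text \<open>By disjointness every pruned neighbour would still send under YTQ, so the YTQ senders
  split into the pruning senders and all pruned neighbours.\<close>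

lemma card_pruning_senders:
  assumes "pruning_run V E L" "1 \<le> t" "t \<le> equilibrium_round V E i" "enat t \<le> L i"
  shows "card (ytq_senders V E i t)
    = card (pruning_senders V E L i t) + (\<Sum>l = 0..t - 1. new_pruned E L i l)"
proof -
  let ?U = "{j \<in> neighbours E i. L j \<le> enat (t - 1)}"
  have "\<not> equilibrium_round V E j \<le> t - 1" if "j \<in> ?U" for j
    using pruned_not_equilibrium[OF assms(1) _ assms(2-4), of j] that assms(2) by fastforce
  then have "ytq_senders V E i t = pruning_senders V E L i t \<union> ?U"
    unfolding ytq_senders_def pruning_senders_def by blast
  moreover have "card (pruning_senders V E L i t \<union> ?U)
      = card (pruning_senders V E L i t) + card ?U"
    by (rule card_Un_disjoint) (auto simp: pruning_senders_def finite_neighbours)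
  ultimately show ?thesis using sum_new_pruned[of L i "t - 1"] by simp
qed

end

text \<open>The minimum is at most \<open>D\<close>, hence finite, and \<open>the_enat\<close> never
  meets \<open>\<infinity>\<close>.\<close>

lemma enat_pruning_last:
  "enat (pruning_last V E L D i) = min (enat (ytq_last V E D i)) (L i)"
  unfolding pruning_last_def ytq_last_def by (cases "L i") auto

theorem mainTheorem3:
  fixes V :: "'a set" and E :: "('a \<times> 'a) set" and L :: "'a \<Rightarrow> enat" and D :: nat and i :: 'a
  assumes "connected_graph V E"
    and "1 \<le> D"
    and "pruning_run V E L"
    and "i \<in> V"
  shows "messages_saved V E L D i =
      (\<Sum>t = 1..pruning_last V E L D i. \<Sum>l = 0..t - 1. int (new_pruned E L i l))
    + (\<Sum>t = pruning_last V E L D i + 1..ytq_last V E D i.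
         int (deg E i) - (\<Sum>l = 0..t - 1. int (new_equilibrium V E i l)))"
proof -
  let ?p = "pruning_last V E L D i" and ?q = "ytq_last V E D i"
  have "enat ?p \<le> enat ?q" and pL: "enat ?p \<le> L i"
    unfolding enat_pruning_last by (rule min.cobounded1, rule min.cobounded2)
  then have pq: "?p \<le> ?q" by simp
  have pruning: "int (card (ytq_senders V E i t)) =
      int (card (pruning_senders V E L i t)) + (\<Sum>l = 0..t - 1. int (new_pruned E L i l))"
    if "t \<in> {1..?p}" for t
  proof -
    have "t \<le> equilibrium_round V E i" using that pq unfolding ytq_last_def by simp
    moreover have "enat t \<le> L i" using order_trans[OF _ pL] that by simp
    ultimately show ?thesis using card_pruning_senders[OF assms(1,3)] that by simp
  qed
  \<comment> \<open>Up to \<open>?p\<close> both methods receive and differ by the pruned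
    neighbours; after \<open>?p\<close> only YTQ receives.\<close>
  have "int (ytq_messages V E D i) = (\<Sum>t = 1..?p. int (card (ytq_senders V E i t)))
      + (\<Sum>t = ?p + 1..?q. int (card (ytq_senders V E i t)))"
    unfolding ytq_messages_def of_nat_sum
    using sum.ub_add_nat[of 1 ?p "\<lambda>t. int (card (ytq_senders V E i t))" "?q - ?p"] pq by simp
  also have "(\<Sum>t = 1..?p. int (card (ytq_senders V E i t))) = int (pruning_messages V E L D i)
      + (\<Sum>t = 1..?p. \<Sum>l = 0..t - 1. int (new_pruned E L i l))"
    unfolding pruning_messages_def of_nat_sum sum.distrib[symmetric]
    by (rule sum.cong[OF refl pruning])
  finally show ?thesis unfolding messages_saved_def card_ytq_senders[OF assms(1)] by simp
qed

end
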